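(* Let $\mathcal{C}$ be a code. Then the following are equivalent: (i) $\operatorname{odim}(\mathcal{C}) = 1$; (ii) $\operatorname{cdim}(\mathcal{C}) = 1$; (iii) $\operatorname{nddim}(\mathcal{C}) = 1$.
   Context: A code is a collection $\mathcal{C} \subseteq 2^{S}$ of subsets of a finite set $S$ (for instance $S = [n] = \{1,\dots,n\}$), where $S$ is called a base set for $\mathcal{C}$; its elements are called codewords. By convention $\emptyset$ is a codeword of every code. For a collection $\mathcal{U} = \{U_i\}_{i \in S}$ of subsets of $\mathbb{R}^d$ indexed by $S$ (sets in the collection may be empty), the code of $\mathcal{U}$ is $$\operatorname{code}(\mathcal{U}) = \{\sigma \subseteq S \mid \text{there exists } p \in \mathbb{R}^d \text{ such that } p \in U_i \text{ if and only if } i \in \sigma\},$$ and $\mathcal{U}$ is called a realization of $\operatorname{code}(\mathcal{U})$. A realization is open (resp. closed) convex if all sets in it are convex and open (resp. convex and closed) in $\mathbb{R}^d$. A collection $\mathcal{U} = \{U_i\}$ of convex open sets is non-degenerate if $\operatorname{code}(\{\operatorname{cl}(U_i)\}) = \operatorname{code}(\mathcal{U})$. A collection $\mathcal{X} = \{X_i\}$ of closed convex sets is non-degenerate if $\operatorname{code}(\{\operatorname{int}(X_i)\}) = \operatorname{code}(\mathcal{X})$. Here $\operatorname{cl}$ and $\operatorname{int}$ denote closure and interior in $\mathbb{R}^d$. The embedding dimensions of $\mathcal{C}$ are defined as follows, with the minimum (over integers $d \ge 0$) of the empty set equal to $\infty$: - $\operatorname{odim}(\mathcal{C}) = \min\{d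 \mid \mathcal{C}$ has an open convex realization in $\mathbb{R}^d\}$; - $\operatorname{cdim}(\mathcal{C}) = \min\{d \mid \mathcal{C}$ has a closed convex realization in $\mathbb{R}^d\}$; - $\operatorname{nddim}(\mathcal{C}) = \min\{d \mid \mathcal{C}$ has a non-degenerate (open or closed) convex realization in $\mathbb{R}^d\}$. *)

theory Defs
  imports "HOL-Analysis.Analysis"
begin

text \<open>
  \<open>\<real>\<^sup>d\<close> for a dimension \<open>d\<close> that varies over all natural numbers (including \<open>d = 0\<close>, a single
  point) is the library space \<^const>\<open>Euclidean_space\<close>, whose points are the sequences
  \<open>x :: nat \<Rightarrow> real\<close> with \<open>x i = 0\<close> for all \<open>i \<ge> d\<close>.
\<close>

definition is_code :: "'a set \<Rightarrow> 'a set set \<Rightarrow> bool" where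
  "is_code S C \<longleftrightarrow> finite S \<and> C \<subseteq> Pow S \<and> {} \<in> C"

definition code_of :: "nat \<Rightarrow> 'a set \<Rightarrow> ('a \<Rightarrow> (nat \<Rightarrow> real) set) \<Rightarrow> 'a set set" where
  "code_of d S U =
     {\<sigma>. \<sigma> \<subseteq> S \<and> (\<exists>p \<in> topspace (Euclidean_space d). \<forall>i\<in>S. p \<in> U i \<longleftrightarrow> i \<in> \<sigma>)}"

text \<open>
  Same as \<^const>\<open>convex\<close>, which does not apply here because the function type
  \<open>nat \<Rightarrow> real\<close> is not an instance of \<open>real_vector\<close>.
\<close>

definition convex_seq :: "(nat \<Rightarrow> real) set \<Rightarrow> bool" where
  "convex_seq A \<longleftrightarrow>
     (\<forall>x\<in>A. \<forall>y\<in>A. \<forall>u\<ge>0. \<forall>v\<ge>0. u + v = 1 \<longrightarrow> (\<lambda>i. u * x i + v * y i) \<in> A)"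

text \<open>
  \<^const>\<open>openin\<close> and \<^const>\<open>closedin\<close> include that the sets are contained in \<open>\<real>\<^sup>d\<close>; values of
  \<open>U\<close> outside the index set \<open>S\<close> are irrelevant.
\<close>

definition open_convex_family :: "nat \<Rightarrow> 'a set \<Rightarrow> ('a \<Rightarrow> (nat \<Rightarrow> real) set) \<Rightarrow> bool" where
  "open_convex_family d S U \<longleftrightarrow> (\<forall>i\<in>S. openin (Euclidean_space d) (U i) \<and> convex_seq (U i))"

definition closed_convex_family :: "nat \<Rightarrow> 'a set \<Rightarrow> ('a \<Rightarrow> (nat \<Rightarrow> real) set) \<Rightarrow> bool" where
  "closed_convex_family d S X \<longleftrightarrow> (\<forall>i\<in>S. closedin (Euclidean_space d) (X i) \<and> convex_seq (X i))"

definition open_convex_realization ::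
  "nat \<Rightarrow> 'a set \<Rightarrow> 'a set set \<Rightarrow> ('a \<Rightarrow> (nat \<Rightarrow> real) set) \<Rightarrow> bool" where
  "open_convex_realization d S C U \<longleftrightarrow> open_convex_family d S U \<and> code_of d S U = C"

definition closed_convex_realization ::
  "nat \<Rightarrow> 'a set \<Rightarrow> 'a set set \<Rightarrow> ('a \<Rightarrow> (nat \<Rightarrow> real) set) \<Rightarrow> bool" where
  "closed_convex_realization d S C X \<longleftrightarrow> closed_convex_family d S X \<and> code_of d S X = C"

definition nondegenerate_open :: "nat \<Rightarrow> 'a set \<Rightarrow> ('a \<Rightarrow> (nat \<Rightarrow> real) set) \<Rightarrow> bool" where
  "nondegenerate_open d S U \<longleftrightarrow>
     code_of d S (\<lambda>i. Euclidean_space d closure_of U i) = code_of d S U"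

definition nondegenerate_closed :: "nat \<Rightarrow> 'a set \<Rightarrow> ('a \<Rightarrow> (nat \<Rightarrow> real) set) \<Rightarrow> bool" where
  "nondegenerate_closed d S X \<longleftrightarrow>
     code_of d S (\<lambda>i. Euclidean_space d interior_of X i) = code_of d S X"

text \<open>
  On \<^typ>\<open>enat\<close> the infimum of a nonempty set is its least element, and the infimum of the
  empty set is \<open>\<infinity>\<close>.
\<close>

definition odim :: "'a set \<Rightarrow> 'a set set \<Rightarrow> enat" where
  "odim S C = Inf {enat d | d. \<exists>U. open_convex_realization d S C U}"

definition cdim :: "'a set \<Rightarrow> 'a set set \<Rightarrow> enat" where
  "cdim S C = Inf {enat d | d. \<exists>X. closed_convex_realization d S C X}"

definition nddim :: "'a set \<Rightarrow> 'a set set \<Rightarrow> enat" where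
  "nddim S C = Inf {enat d | d.
     (\<exists>U. open_convex_realization d S C U \<and> nondegenerate_open d S U) \<or>
     (\<exists>X. closed_convex_realization d S C X \<and> nondegenerate_closed d S X)}"

end

theory Submission
  imports Defs
begin

text \<open>
  Each of the three dimensions is 1 iff a realization of the respective kind exists in dimension 1
  but not in dimension 0.  So it is enough that in dimensions 0 and 1 the three kinds of
  realization exist for the same codes.

  In dimension 0 there is only one point, so the only code with the empty codeword is \<open>{{}}\<close>,
  which the family of empty sets realizes in every sense.

  In dimension 1 a realization, open or closed, consists of finitely many intervals.  Choose
  finitely many sample points: all endpoints, the midpoints between them, and points beyond the
  extreme ones.  Each codeword occurs at a sample point.  Of any two consecutive sample points at
  most one is an endpoint, and their two codewords are comparable: on arrival at an endpoint, sets
  of an open family can only be left, and sets of a closed family can only be entered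
  (\<open>ex_sampling\<close>).  Now replace every interval by the hull of its sample points, enlarged by a
  small \<open>e\<close> on both sides.  Near a sample point the codeword is the old one at that
  point; between two consecutive sample points it is the intersection of their codewords, which is
  one of the two; elsewhere it is empty, and the empty set is a codeword.  This holds whether the
  enlarged hulls are taken open or closed (\<open>range_word_thicken\<close>).  The open ones therefore form a
  non-degenerate open realization, and their closures a closed one.  All three kinds of
  realization thus arise from any open or closed one.
\<close>

section \<open>Codewords along the real line\<close>

definition word :: "'a set \<Rightarrow> ('a \<Rightarrow> 'p set) \<Rightarrow> 'p \<Rightarrow> 'a set" where
  "word S V t = {i \<in> S. t \<in> V i}"

lemma finite_frontier_convex_real:
  fixes A :: "real set"
  assumes "convex A"
  shows "finite (frontier A)"
proof -
  have "x \<in> A" if "a \<in> A" "b \<in> A" "a \<le> x" "x \<le> b" for a b x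
    using assms that mem_is_interval_1_I[of A a b x] by (simp add: is_interval_convex_1)
  then have "\<exists>a b. A = {} \<or> A = UNIV \<or> A = {..<b} \<or> A = {..b} \<or> A = {a<..} \<or> A = {a..} \<or>
      A = {a<..<b} \<or> A = {a<..b} \<or> A = {a..<b} \<or> A = {a..b}"
    by (rule interval_cases)
  then obtain a b where A: "A = {} \<or> A = UNIV \<or> A = {..<b} \<or> A = {..b} \<or> A = {a<..} \<or> A = {a..} \<or>
      A = {a<..<b} \<or> A = {a<..b} \<or> A = {a..<b} \<or> A = {a..b}"
    by (elim exE)
  have "closure A - interior A \<subseteq> {a, b}"
  proof (cases "a < b")
    case True
    from A show ?thesis by (elim disjE) (use True in \<open>auto simp: interior_open\<close>)
  next
    case False
    from A show ?thesis by (elim disjE; cases "a = b") (use False in \<open>auto simp: interior_open\<close>)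
  qed
  then show ?thesis
    unfolding frontier_def by (rule finite_subset) simp
qed

lemma word_constant_on_connected:
  assumes "connected T" "T \<inter> (\<Union>i\<in>S. frontier (V i)) = {}" "s \<in> T" "t \<in> T"
  shows "word S V s = word S V t"
proof -
  have "s \<in> V i \<longleftrightarrow> t \<in> V i" if "i \<in> S" for i
    using connected_Int_frontier[OF assms(1), of "V i"] assms(2-4) that by blast
  then show ?thesis by (auto simp: word_def)
qed

text \<open>
  On \<open>T\<close> the codeword is constant.  In the limit an open family can only lose members, because
  an open set containing \<open>x\<close> meets \<open>T\<close>; a closed family can only gain members.  This is the one
  place where openness or closedness of a realization matters.
\<close>

lemma word_nested_at_closure:
  assumes oc: "(\<forall>i\<in>S. open (V i)) \<or> (\<forall>i\<in>S. closed (V i))"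
    and T: "connected T" "T \<inter> (\<Union>i\<in>S. frontier (V i)) = {}"
    and t: "t \<in> T" and x: "x \<in> closure T"
  shows "word S V x \<subseteq> word S V t \<or> word S V t \<subseteq> word S V x"
  using oc
proof
  assume op: "\<forall>i\<in>S. open (V i)"
  have "t \<in> V i" if i: "i \<in> S" "x \<in> V i" for i
  proof -
    obtain s where "s \<in> T" "s \<in> V i"
      using x i op open_Int_closure_eq_empty[of "V i" T] by blast
    with word_constant_on_connected[OF T \<open>s \<in> T\<close> t] i show ?thesis
      by (auto simp: word_def)
  qed
  then show ?thesis by (auto simp: word_def)
next
  assume cl: "\<forall>i\<in>S. closed (V i)"
  have "x \<in> V i" if i: "i \<in> S" "t \<in> V i" for i
  proof -
    have "T \<subseteq> V i"
      using word_constant_on_connected[OF T _ t] i by (auto simp: word_def)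
    with x i cl closure_minimal show ?thesis by blast
  qed
  then show ?thesis by (auto simp: word_def)
qed

text \<open>
  The combinatorial data that the open and the closed case share: finitely many points that show
  all codewords, with comparable codewords at neighbouring points.
\<close>

definition sampling :: "'a set \<Rightarrow> ('a \<Rightarrow> real set) \<Rightarrow> real set \<Rightarrow> bool" where
  "sampling S V P \<longleftrightarrow> finite P \<and> word S V ` P = range (word S V) \<and>
    (\<forall>p\<in>P. \<forall>q\<in>P. p < q \<and> {p<..<q} \<inter> P = {} \<longrightarrow>
      word S V p \<subseteq> word S V q \<or> word S V q \<subseteq> word S V p)"

text \<open>
  The sample consists of the endpoints and at least one point in each component of their
  complement.  Midpoints of all pairs of endpoints are taken, not only of neighbouring ones; extra
  points are harmless, and two endpoints are then never consecutive in the sample.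
\<close>

lemma ex_sampling:
  fixes V :: "'a \<Rightarrow> real set"
  assumes S: "finite S" and conv: "\<And>i. i \<in> S \<Longrightarrow> convex (V i)"
    and oc: "(\<forall>i\<in>S. open (V i)) \<or> (\<forall>i\<in>S. closed (V i))"
  obtains P where "sampling S V P"
proof -
  define F where "F = (\<Union>i\<in>S. frontier (V i))"
  \<comment> \<open>The additional point 0 avoids a separate case for families without any endpoint.\<close>
  define E where "E = insert 0 F"
  define P where "P = E \<union> (\<lambda>(a, b). (a + b) / 2) ` (E \<times> E) \<union> (\<lambda>a. a - 1) ` E \<union> (\<lambda>a. a + 1) ` E"
  have finE: "finite E"
    unfolding E_def F_def using S conv finite_frontier_convex_real by auto
  have const: "word S V s = word S V t" if "connected T" "T \<inter> E = {}" "s \<in> T" "t \<in> T" for T s t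
    using word_constant_on_connected[where T = T and S = S and V = V and s = s and t = t] that unfolding E_def F_def by blast
  have "word S V x \<in> word S V ` P" for x
  proof -
    define L where "L = {e \<in> E. e < x}"
    define R where "R = {e \<in> E. x < e}"
    have fin: "finite L" "finite R" using finE by (auto simp: L_def R_def)
    consider "x \<in> E" | "x \<notin> E" "L = {}" | "x \<notin> E" "R = {}" | "x \<notin> E" "L \<noteq> {}" "R \<noteq> {}"
      by blast
    then show ?thesis
    proof cases
      case 1
      then show ?thesis by (auto simp: P_def)
    next
      case 2
      then have "x < e" if "e \<in> E" for e
        using that by (cases rule: linorder_cases[of x e]) (auto simp: L_def)
      then have "R = E" by (auto simp: R_def)
      then have M: "Min R \<in> R" using fin Min_in[of R] by (auto simp: E_def)
      have "word S V x = word S V (Min R - 1)"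
      proof (rule const[of "{..<Min R}"])
        show "{..<Min R} \<inter> E = {}" using \<open>R = E\<close> fin by (auto simp: not_less dest: Min_le)
      qed (use M in \<open>auto simp: R_def\<close>)
      moreover have "Min R - 1 \<in> P" using M by (auto simp: P_def R_def)
      ultimately show ?thesis by blast
    next
      case 3
      then have "e < x" if "e \<in> E" for e
        using that by (cases rule: linorder_cases[of x e]) (auto simp: R_def)
      then have "L = E" by (auto simp: L_def)
      then have M: "Max L \<in> L" using fin Max_in[of L] by (auto simp: E_def)
      have "word S V x = word S V (Max L + 1)"
      proof (rule const[of "{Max L<..}"])
        show "{Max L<..} \<inter> E = {}" using \<open>L = E\<close> fin by (auto simp: not_less dest: Max_ge)
      qed (use M in \<open>auto simp: L_def\<close>)
      moreover have "Max L + 1 \<in> P" using M by (auto simp: P_def L_def)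
      ultimately show ?thesis by blast
    next
      case 4
      then have M: "Max L \<in> L" "Min R \<in> R" using fin by auto
      have "word S V x = word S V ((Max L + Min R) / 2)"
      proof (rule const[of "{Max L<..<Min R}"])
        have "e \<le> Max L \<or> Min R \<le> e" if "e \<in> E" for e
          using that fin \<open>x \<notin> E\<close> Max_ge[of L e] Min_le[of R e]
          by (cases rule: linorder_cases[of e x]) (auto simp: L_def R_def)
        then show "{Max L<..<Min R} \<inter> E = {}" by force
      qed (use M in \<open>auto simp: L_def R_def\<close>)
      moreover have "(Max L + Min R) / 2 \<in> P"
        using M by (auto simp: P_def L_def R_def)
      ultimately show ?thesis by blast
    qed
  qed
  then have cover: "word S V ` P = range (word S V)" by blast
  have nested: "word S V p \<subseteq> word S V q \<or> word S V q \<subseteq> word S V p"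
    if pq: "p \<in> P" "q \<in> P" "p < q" and gap: "{p<..<q} \<inter> P = {}" for p q
  proof -
    have avoid: "e \<notin> E" if "p < e" "e < q" for e
      using gap that by (auto simp: P_def)
    have "\<not> (p \<in> E \<and> q \<in> E)"
    proof
      assume "p \<in> E \<and> q \<in> E"
      then have "(p + q) / 2 \<in> P" by (auto simp: P_def)
      moreover have "(p + q) / 2 \<in> {p<..<q}" using \<open>p < q\<close> by simp
      ultimately show False using gap by blast
    qed
    then consider "p \<notin> E" | "q \<notin> E" by blast
    then show ?thesis
    proof cases
      case 1
      with avoid have "{p..<q} \<inter> E = {}" by (auto simp: le_less)
      then have "word S V q \<subseteq> word S V p \<or> word S V p \<subseteq> word S V q"
        using \<open>p < q\<close> by (intro word_nested_at_closure[OF oc, of "{p..<q}"]) (auto simp: E_def F_def)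
      then show ?thesis by blast
    next
      case 2
      with avoid have "{p<..q} \<inter> E = {}" by (auto simp: le_less)
      then show ?thesis
        using \<open>p < q\<close> by (intro word_nested_at_closure[OF oc, of "{p<..q}"]) (auto simp: E_def F_def)
    qed
  qed
  have "finite P" using finE by (auto simp: P_def)
  with cover nested have "sampling S V P" by (simp add: sampling_def)
  then show thesis by (rule that)
qed

section \<open>Thickened hulls\<close>

text \<open>
  The predicate \<open>R\<close> says which signed overshoots beyond the hull of \<open>A\<close> are allowed.  With
  \<open>t < e\<close> and \<open>t \<le> e\<close> this is the open and the closed \<open>e\<close>-neighbourhood of the hull, so that
  both can be treated at once.
\<close>

definition thicken :: "(real \<Rightarrow> bool) \<Rightarrow> real set \<Rightarrow> real set" where
  "thicken R A = {x. \<exists>p\<in>A. \<exists>q\<in>A. R (p - x) \<and> R (x - q)}"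

lemma thicken_eq_interval:
  assumes "finite A" "A \<noteq> {}"
  shows "thicken (\<lambda>t. t < e) A = {Min A - e<..<Max A + e}"
    and "thicken (\<lambda>t. t \<le> e) A = {Min A - e..Max A + e}"
proof -
  have "x \<in> thicken R A \<longleftrightarrow> R (Min A - x) \<and> R (x - Max A)"
    if R: "\<And>s t. R t \<Longrightarrow> s \<le> t \<Longrightarrow> R s" for R x
  proof
    assume "x \<in> thicken R A"
    then obtain p q where "p \<in> A" "q \<in> A" "R (p - x)" "R (x - q)"
      by (auto simp: thicken_def)
    with assms R[of "p - x" "Min A - x"] R[of "x - q" "x - Max A"]
    show "R (Min A - x) \<and> R (x - Max A)" by auto
  next
    assume "R (Min A - x) \<and> R (x - Max A)"
    then show "x \<in> thicken R A"
      using Min_in[OF assms] Max_in[OF assms] unfolding thicken_def by blast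
  qed
  from this[of "\<lambda>t. t < e"] this[of "\<lambda>t. t \<le> e"]
  show "thicken (\<lambda>t. t < e) A = {Min A - e<..<Max A + e}"
    and "thicken (\<lambda>t. t \<le> e) A = {Min A - e..Max A + e}"
    by (auto simp: set_eq_iff)
qed

lemma thicken_empty [simp]: "thicken R {} = {}"
  by (simp add: thicken_def)

lemma thicken_less:
  assumes "finite A" "0 < e"
  shows "open (thicken (\<lambda>t. t < e) A)" "convex (thicken (\<lambda>t. t < e) A)"
    "closure (thicken (\<lambda>t. t < e) A) = thicken (\<lambda>t. t \<le> e) A"
proof -
  have *: "Min A - e < Max A + e" if "A \<noteq> {}"
    using assms Min_le[OF assms(1) Max_in[OF assms(1) that]] by linarith
  show "open (thicken (\<lambda>t. t < e) A)" "convex (thicken (\<lambda>t. t < e) A)"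
    using assms by (cases "A = {}"; simp add: thicken_eq_interval)+
  show "closure (thicken (\<lambda>t. t < e) A) = thicken (\<lambda>t. t \<le> e) A"
    using assms * by (cases "A = {}"; simp add: thicken_eq_interval)
qed

text \<open>
  A point is either close to some sample point \<open>p\<close>, in the sense of \<open>R\<close>, or not.  If it is, its
  codeword is that of \<open>p\<close>: a hull that reaches the point but misses \<open>p\<close> would have an end within
  \<open>2 * e\<close> of \<open>p\<close>.  If it is not, only hulls that extend to both sides of the point contain it, so
  its codeword is the intersection of the codewords at the neighbouring sample points, or empty
  if there is no sample point on one side.
\<close>

lemma range_word_thicken:
  fixes V :: "'a \<Rightarrow> real set"
  assumes conv: "\<And>i. i \<in> S \<Longrightarrow> convex (V i)"
    and P: "sampling S V P"
    and empty: "{} \<in> range (word S V)"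
    and sep: "\<And>p q. \<lbrakk>p \<in> P; q \<in> P; p < q\<rbrakk> \<Longrightarrow> 2 * e < q - p"
    and R0: "\<And>t. t \<le> 0 \<Longrightarrow> R t" and Re: "\<And>t. R t \<Longrightarrow> t \<le> e"
  shows "range (word S (\<lambda>i. thicken R (P \<inter> V i))) = range (word S V)"
proof -
  define W where "W = (\<lambda>i. thicken R (P \<inter> V i))"
  have between: "r \<in> V i" if "i \<in> S" "p \<in> V i" "q \<in> V i" "p \<le> r" "r \<le> q" for i p q r
    using conv[OF \<open>i \<in> S\<close>] that mem_is_interval_1_I[of "V i" p q r] by (simp add: is_interval_convex_1)
  have near: "word S W x = word S V p" if p: "p \<in> P" "R (p - x)" "R (x - p)" for x p
  proof -
    have "p \<in> V i" if i: "i \<in> S" "x \<in> W i" for i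
    proof -
      obtain a b where ab: "a \<in> P" "a \<in> V i" "b \<in> P" "b \<in> V i" "R (a - x)" "R (x - b)"
        using i by (auto simp: W_def thicken_def)
      have "a \<le> p"
        using sep[of p a] Re[OF ab(5)] Re[OF p(3)] p(1) ab(1) by linarith
      moreover have "p \<le> b"
        using sep[of b p] Re[OF ab(6)] Re[OF p(2)] p(1) ab(3) by linarith
      ultimately show ?thesis using between ab i by blast
    qed
    with p show ?thesis by (auto simp: word_def W_def thicken_def)
  qed
  have far: "word S W x \<in> range (word S V)" if x: "\<nexists>p. p \<in> P \<and> R (p - x) \<and> R (x - p)" for x
  proof -
    have strict: "\<exists>a\<in>P. \<exists>b\<in>P. a \<in> V i \<and> b \<in> V i \<and> a < x \<and> x < b" if i: "i \<in> word S W x" for i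
    proof -
      obtain a b where ab: "a \<in> P" "a \<in> V i" "b \<in> P" "b \<in> V i" "R (a - x)" "R (x - b)"
        using i by (auto simp: W_def thicken_def word_def)
      have "a < x" using x ab(1,5) R0[of "x - a"] by force
      moreover have "x < b" using x ab(3,6) R0[of "b - x"] by force
      ultimately show ?thesis using ab by blast
    qed
    define A where "A = {p \<in> P. p < x}"
    define B where "B = {p \<in> P. x < p}"
    have fin: "finite A" "finite B" using P by (auto simp: A_def B_def sampling_def)
    show ?thesis
    proof (cases "A = {} \<or> B = {}")
      case True
      then have "word S W x = {}" using strict by (fastforce simp: A_def B_def)
      with empty show ?thesis by simp
    next
      case False
      define p q where "p = Max A" and "q = Min B"
      have pA: "p \<in> A" and qB: "q \<in> B" using False fin by (auto simp: p_def q_def)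
      have pq: "p \<in> P" "q \<in> P" "p < x" "x < q" using pA qB by (auto simp: A_def B_def)
      have "x \<notin> P" using x R0[of 0] by (metis diff_self order_refl)
      have gap: "r \<le> p \<or> q \<le> r" if "r \<in> P" for r
        using that fin \<open>x \<notin> P\<close> Max_ge[of A r] Min_le[of B r] unfolding p_def q_def
        by (cases rule: linorder_cases[of r x]) (auto simp: A_def B_def)
      then have "{p<..<q} \<inter> P = {}" by force
      then have n: "word S V p \<subseteq> word S V q \<or> word S V q \<subseteq> word S V p"
        using P pq by (simp add: sampling_def)
      have "word S W x = word S V p \<inter> word S V q"
      proof
        show "word S W x \<subseteq> word S V p \<inter> word S V q"
        proof
          fix i assume i: "i \<in> word S W x"
          then have iS: "i \<in> S" by (simp add: word_def)
          obtain a b where ab: "a \<in> P" "b \<in> P" "a \<in> V i" "b \<in> V i" "a < x" "x < b"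
            using strict[OF i] by blast
          then have "a \<le> p" "q \<le> b" using gap[of a] gap[of b] pq by auto
          then have "p \<in> V i" "q \<in> V i" using between[OF iS ab(3,4)] pq by auto
          with iS show "i \<in> word S V p \<inter> word S V q" by (simp add: word_def)
        qed
        show "word S V p \<inter> word S V q \<subseteq> word S W x"
          using pq R0[of "p - x"] R0[of "x - q"] by (auto simp: word_def W_def thicken_def)
      qed
      with n have "word S W x = word S V p \<or> word S W x = word S V q" by blast
      then show ?thesis by auto
    qed
  qed
  have "range (word S W) = range (word S V)"
  proof
    show "range (word S W) \<subseteq> range (word S V)" using near far by blast
    have "word S V p \<in> range (word S W)" if "p \<in> P" for p
      using near[OF that, of p] R0[of 0] by auto
    then show "range (word S V) \<subseteq> range (word S W)"
      using P unfolding sampling_def by (metis image_subsetI)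
  qed
  then show ?thesis by (simp add: W_def)
qed

text \<open>
  The second equation about \<open>range\<close> serves twice: it is the non-degeneracy of \<open>W\<close>, and it makes
  the closures of \<open>W\<close> a closed realization.
\<close>

lemma nondegenerate_on_line:
  fixes V :: "'a \<Rightarrow> real set"
  assumes S: "finite S" and conv: "\<And>i. i \<in> S \<Longrightarrow> convex (V i)"
    and oc: "(\<forall>i\<in>S. open (V i)) \<or> (\<forall>i\<in>S. closed (V i))"
    and empty: "{} \<in> range (word S V)"
  obtains W :: "'a \<Rightarrow> real set" where "\<forall>i. open (W i) \<and> convex (W i)"
    "range (word S W) = range (word S V)"
    "range (word S (\<lambda>i. closure (W i))) = range (word S V)"
proof -
  obtain P where P: "sampling S V P"
    by (rule ex_sampling[OF S conv oc])
  then have "uniform_discrete P"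
    by (simp add: sampling_def uniform_discrete_finite_iff[THEN iffD2, THEN conjunct1])
  then obtain d where d: "d > 0" "\<forall>p\<in>P. \<forall>q\<in>P. dist p q < d \<longrightarrow> p = q"
    unfolding uniform_discrete_def by blast
  \<comment> \<open>Any \<open>e\<close> below half the least distance of sample points would do.\<close>
  define e where "e = d / 3"
  have e_pos: "e > 0" using d(1) by (simp add: e_def)
  have sep: "2 * e < q - p" if "p \<in> P" "q \<in> P" "p < q" for p q
  proof -
    have "\<not> dist p q < d"
      using d(2) that by blast
    with \<open>p < q\<close> have "d \<le> q - p"
      by (simp add: dist_real_def)
    with d(1) show "2 * e < q - p" by (simp add: e_def)
  qed
  define W where "W i = thicken (\<lambda>t. t < e) (P \<inter> V i)" for i
  have fin: "finite (P \<inter> V i)" for i using P by (simp add: sampling_def)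
  have cl: "closure (W i) = thicken (\<lambda>t. t \<le> e) (P \<inter> V i)" for i
    unfolding W_def by (rule thicken_less(3)[OF fin e_pos])
  show thesis
  proof
    show "\<forall>i. open (W i) \<and> convex (W i)"
      unfolding W_def using thicken_less(1,2)[OF fin e_pos] by auto
    show "range (word S W) = range (word S V)"
      unfolding W_def by (rule range_word_thicken[OF conv P empty sep]) (use e_pos in auto)
    show "range (word S (\<lambda>i. closure (W i))) = range (word S V)"
      unfolding cl by (rule range_word_thicken[OF conv P empty sep]) (use e_pos in auto)
  qed
qed

section \<open>Realizations in dimensions one and zero\<close>

text \<open>
  The homeomorphism from the real line to \<open>Euclidean_space 1\<close>, written so that it matches
  \<open>continuous_map_componentwise_Euclidean_space\<close>.
\<close>

definition axis_point :: "real \<Rightarrow> nat \<Rightarrow> real" where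
  "axis_point t = (\<lambda>i. if i < 1 then t else 0)"

lemma axis_point_0 [simp]: "axis_point t 0 = t"
  by (simp add: axis_point_def)

lemma homeomorphic_map_axis_point: "homeomorphic_map euclideanreal (Euclidean_space 1) axis_point"
proof -
  have "continuous_map euclideanreal (Euclidean_space 1) axis_point"
    unfolding axis_point_def
    by (subst continuous_map_componentwise_Euclidean_space) simp
  moreover have "continuous_map (Euclidean_space 1) euclideanreal (\<lambda>x. x 0)"
    unfolding Euclidean_space_def
    by (intro continuous_map_from_subtopology continuous_map_product_projection) simp
  ultimately have "homeomorphic_maps euclideanreal (Euclidean_space 1) axis_point (\<lambda>x. x 0)"
    by (auto simp: homeomorphic_maps_def topspace_Euclidean_space axis_point_def)
  then show ?thesis by (simp add: homeomorphic_maps_map)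
qed

lemma range_axis_point: "range axis_point = topspace (Euclidean_space 1)"
  using homeomorphic_imp_surjective_map[OF homeomorphic_map_axis_point] by simp

lemma inj_axis_point: "inj axis_point"
  by (rule inj_on_inverseI[of _ "\<lambda>x. x 0"]) simp

lemma code_of_eq_word_image: "code_of d S U = word S U ` topspace (Euclidean_space d)"
proof -
  have "\<sigma> \<subseteq> S \<and> (\<forall>i\<in>S. p \<in> U i \<longleftrightarrow> i \<in> \<sigma>) \<longleftrightarrow> \<sigma> = word S U p" for \<sigma> p
    unfolding word_def by blast
  then show ?thesis
    unfolding code_of_def image_def by blast
qed

lemma code_of_1: "code_of 1 S U = range (word S (\<lambda>i. axis_point -` U i))"
  unfolding code_of_eq_word_image range_axis_point[symmetric] image_image word_def vimage_eq ..

lemma code_of_1_image: "code_of 1 S (\<lambda>i. axis_point ` V i) = range (word S V)"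
  unfolding code_of_1 inj_vimage_image_eq[OF inj_axis_point] ..

lemma axis_point_vimage:
  assumes "U \<subseteq> topspace (Euclidean_space 1)"
  shows "axis_point ` (axis_point -` U) = U"
  unfolding image_vimage_eq range_axis_point using assms by (rule Int_absorb2)

lemma convex_seq_axis_point_image:
  assumes "convex V"
  shows "convex_seq (axis_point ` V)"
  unfolding convex_seq_def
proof (intro ballI allI impI)
  fix x y u v assume "x \<in> axis_point ` V" "y \<in> axis_point ` V" and uv: "0 \<le> u" "0 \<le> v" "u + v = (1::real)"
  then obtain s t where st: "s \<in> V" "t \<in> V" "x = axis_point s" "y = axis_point t" by blast
  have "(\<lambda>i. u * x i + v * y i) = axis_point (u * s + v * t)"
    by (auto simp: st axis_point_def)
  moreover have "u * s + v * t \<in> V"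
    using convexD[OF assms st(1,2) uv] by simp
  ultimately show "(\<lambda>i. u * x i + v * y i) \<in> axis_point ` V" by simp
qed

lemma convex_axis_point_vimage:
  assumes "convex_seq U"
  shows "convex (axis_point -` U)"
proof (rule convexI)
  fix s t u v :: real
  assume st: "s \<in> axis_point -` U" "t \<in> axis_point -` U" and uv: "0 \<le> u" "0 \<le> v" "u + v = 1"
  have "axis_point (u *\<^sub>R s + v *\<^sub>R t) = (\<lambda>i. u * axis_point s i + v * axis_point t i)"
    by (auto simp: axis_point_def)
  with assms st uv show "u *\<^sub>R s + v *\<^sub>R t \<in> axis_point -` U"
    by (simp add: convex_seq_def)
qed

lemma openin_axis_point_image: "openin (Euclidean_space 1) (axis_point ` V) \<longleftrightarrow> open V"
  using homeomorphic_map_openness[OF homeomorphic_map_axis_point, of V] by simp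

lemma closedin_axis_point_image: "closedin (Euclidean_space 1) (axis_point ` V) \<longleftrightarrow> closed V"
  using homeomorphic_map_closedness[OF homeomorphic_map_axis_point, of V] by simp

lemma closure_of_axis_point_image:
  "Euclidean_space 1 closure_of (axis_point ` V) = axis_point ` closure V"
  using homeomorphic_map_closure_of[OF homeomorphic_map_axis_point, of V] by simp

lemma nondegenerate_open_realization_1:
  assumes C: "is_code S C"
    and real: "open_convex_realization 1 S C U \<or> closed_convex_realization 1 S C U"
  obtains W where "open_convex_realization 1 S C W" "nondegenerate_open 1 S W"
    "closed_convex_realization 1 S C (\<lambda>i. Euclidean_space 1 closure_of W i)"
proof -
  define V where "V = (\<lambda>i. axis_point -` U i)"
  have code: "range (word S V) = C"
    using real code_of_1[of S U]
    by (auto simp: V_def open_convex_realization_def closed_convex_realization_def)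
  have conv: "\<And>i. i \<in> S \<Longrightarrow> convex (V i)"
    using real convex_axis_point_vimage
    by (auto simp: V_def open_convex_realization_def closed_convex_realization_def
        open_convex_family_def closed_convex_family_def)
  have oc: "(\<forall>i\<in>S. open (V i)) \<or> (\<forall>i\<in>S. closed (V i))"
  proof -
    have "open (V i)" if "openin (Euclidean_space 1) (U i)" for i
      using that openin_axis_point_image[of "V i"] axis_point_vimage[OF openin_subset[OF that]]
      by (simp add: V_def del: One_nat_def)
    moreover have "closed (V i)" if "closedin (Euclidean_space 1) (U i)" for i
      using that closedin_axis_point_image[of "V i"] axis_point_vimage[OF closedin_subset[OF that]]
      by (simp add: V_def del: One_nat_def)
    ultimately show ?thesis
      using real unfolding open_convex_realization_def closed_convex_realization_def
        open_convex_family_def closed_convex_family_def by blast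
  qed
  have fin: "finite S" and empty: "{} \<in> range (word S V)"
    using C code by (auto simp: is_code_def)
  obtain W :: "'a \<Rightarrow> real set" where W: "\<forall>i. open (W i) \<and> convex (W i)"
    "range (word S W) = C" "range (word S (\<lambda>i. closure (W i))) = C"
    by (rule nondegenerate_on_line[OF fin conv oc empty, unfolded code])
  show thesis
  proof
    show "open_convex_realization 1 S C (\<lambda>i. axis_point ` W i)"
      using W unfolding open_convex_realization_def open_convex_family_def
      by (simp add: openin_axis_point_image convex_seq_axis_point_image code_of_1_image
          del: One_nat_def)
    show "nondegenerate_open 1 S (\<lambda>i. axis_point ` W i)"
      using W unfolding nondegenerate_open_def
      by (simp add: closure_of_axis_point_image code_of_1_image del: One_nat_def)
    show "closed_convex_realization 1 S C (\<lambda>i. Euclidean_space 1 closure_of axis_point ` W i)"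
      using W unfolding closed_convex_realization_def closed_convex_family_def
      by (simp add: closedin_axis_point_image closure_of_axis_point_image convex_seq_axis_point_image
          code_of_1_image del: One_nat_def)
  qed
qed

lemma code_of_0: "code_of 0 S U = {word S U (\<lambda>i. 0)}"
proof -
  have "topspace (Euclidean_space 0) = {\<lambda>i. 0}"
    by (auto simp: topspace_Euclidean_space)
  then show ?thesis by (simp add: code_of_eq_word_image)
qed

lemma empty_family_realization_0:
  assumes "is_code S C" "code_of 0 S U = C"
  shows "open_convex_realization 0 S C (\<lambda>i. {})" "closed_convex_realization 0 S C (\<lambda>i. {})"
    "nondegenerate_open 0 S (\<lambda>i. {})"
proof -
  have "C = {{}}"
    using assms unfolding is_code_def code_of_0 by blast
  then show "open_convex_realization 0 S C (\<lambda>i. {})" "closed_convex_realization 0 S C (\<lambda>i. {})"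
    "nondegenerate_open 0 S (\<lambda>i. {})"
    by (simp_all add: open_convex_realization_def closed_convex_realization_def nondegenerate_open_def
        open_convex_family_def closed_convex_family_def code_of_0 word_def convex_seq_def)
qed

lemma Inf_enat_eq_1_iff: "Inf {enat d | d. Q d} = 1 \<longleftrightarrow> Q 1 \<and> \<not> Q 0"
proof
  let ?D = "{enat d | d. Q d}"
  assume *: "Inf ?D = 1"
  have ne: "?D \<noteq> {}"
  proof
    assume "?D = {}"
    then have "Inf ?D = \<infinity>" by (simp only: Inf_empty top_enat_def)
    with * show False by (simp only: infinity_ne_i1)
  qed
  then obtain x where "x \<in> ?D" by (rule ex_in_conv[THEN iffD2, THEN exE])
  then have "(LEAST x. x \<in> ?D) \<in> ?D" by (rule LeastI)
  with ne have "Inf ?D \<in> ?D"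
    by (simp only: Inf_enat_def if_False)
  with * have "Q 1" by (auto simp: one_enat_def)
  moreover have "\<not> Q 0"
  proof
    assume "Q 0"
    then have "Inf ?D \<le> enat 0" by (intro Inf_lower) blast
    with * show False by (simp add: one_enat_def)
  qed
  ultimately show "Q 1 \<and> \<not> Q 0" by blast
next
  assume Q: "Q 1 \<and> \<not> Q 0"
  have "1 \<le> d" if "Q d" for d
    using that Q by (cases d) auto
  with Q show "Inf {enat d | d. Q d} = 1"
    by (intro antisym Inf_lower Inf_greatest) (auto simp: one_enat_def)
qed

theorem theorem1p8:
  fixes S :: "'a set" and C :: "'a set set"
  assumes "is_code S C"
  shows "(odim S C = 1 \<longleftrightarrow> cdim S C = 1) \<and> (cdim S C = 1 \<longleftrightarrow> nddim S C = 1)"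
proof -
  define Op where "Op d \<longleftrightarrow> (\<exists>U. open_convex_realization d S C U)" for d
  define Cl where "Cl d \<longleftrightarrow> (\<exists>X. closed_convex_realization d S C X)" for d
  define Nd where "Nd d \<longleftrightarrow> (\<exists>U. open_convex_realization d S C U \<and> nondegenerate_open d S U) \<or>
     (\<exists>X. closed_convex_realization d S C X \<and> nondegenerate_closed d S X)" for d
  have code: "code_of d S U = C"
    if "open_convex_realization d S C U \<or> closed_convex_realization d S C U" for d U
    using that by (auto simp: open_convex_realization_def closed_convex_realization_def)
  have dims: "odim S C = 1 \<longleftrightarrow> Op 1 \<and> \<not> Op 0" "cdim S C = 1 \<longleftrightarrow> Cl 1 \<and> \<not> Cl 0"
    "nddim S C = 1 \<longleftrightarrow> Nd 1 \<and> \<not> Nd 0"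
    unfolding odim_def cdim_def nddim_def Inf_enat_eq_1_iff Op_def Cl_def Nd_def by (rule refl)+
  have 0: "Op 0 \<and> Cl 0 \<and> Nd 0"
    if "open_convex_realization 0 S C U \<or> closed_convex_realization 0 S C U" for U
    using empty_family_realization_0[OF assms code[OF that]]
    unfolding Op_def Cl_def Nd_def by blast
  have 1: "Op 1 \<and> Cl 1 \<and> Nd 1"
    if real: "open_convex_realization 1 S C U \<or> closed_convex_realization 1 S C U" for U
  proof -
    obtain W where "open_convex_realization 1 S C W" "nondegenerate_open 1 S W"
      "closed_convex_realization 1 S C (\<lambda>i. Euclidean_space 1 closure_of W i)"
      by (rule nondegenerate_open_realization_1[OF assms real])
    then show ?thesis unfolding Op_def Cl_def Nd_def by blast
  qed
  have real: "\<exists>U. open_convex_realization d S C U \<or> closed_convex_realization d S C U"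
    if "Op d \<or> Cl d \<or> Nd d" for d
    using that unfolding Op_def Cl_def Nd_def by blast
  have all_0: "Op 0 \<and> Cl 0 \<and> Nd 0" if "Op 0 \<or> Cl 0 \<or> Nd 0"
    by (rule exE[OF real[OF that]]) (rule 0)
  have all_1: "Op 1 \<and> Cl 1 \<and> Nd 1" if "Op 1 \<or> Cl 1 \<or> Nd 1"
    by (rule exE[OF real[OF that]]) (rule 1)
  show ?thesis
    unfolding dims using all_0 all_1 by argo
qed

end
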